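(* Let $k$ be an infinite field, and let $p:=\operatorname{char}k$ if this is positive and $p:=\infty$ otherwise. Let $V$ be a $k$-vector space of finite dimension $\ell$. Let $n\ge m\ge\ell$ and let $d\ge 0$ be an integer with $d\le(p-1)m$ (no condition on $d$ if $\operatorname{char}k=0$). Then $$k[V^{\oplus n}]_d=\langle k[V^{\oplus m}]_d\rangle_{GL(n)}.$$
   Context: For a finite dimensional $k$-vector space $W$, $k[W]_d=S^d(W^* )$ is the space of polynomial functions on $W$ that are homogeneous of degree $d$. $V^{\oplus n}=V\otimes_kk^n$ is the space of $n$-tuples of vectors in $V$, with the natural action of $GL(n)=GL_n(k)$ (via $k^n$), which induces an action on $k[V^{\oplus n}]$. For a subset $S\subseteq k[V^{\oplus n}]$, $\langle S\rangle_{GL(n)}$ is the $GL(n)$-submodule (i.e. $GL(n)$-stable $k$-linear subspace) generated by $S$. For $m\le n$, $V^{\oplus m}$ is regarded as the quotient of $V^{\oplus n}$ obtained by forgetting the last $n-m$ components, and $k[V^{\oplus m}]$ is accordingly viewed as a subring of $k[V^{\oplus n}]$ by pullback. *)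

theory Defs
  imports "HOL-Library.Function_Algebras" "Jordan_Normal_Form.Matrix"
begin

section \<open>Polynomial functions on a vector space\<close>

text \<open>
  A vector space \<open>W\<close> over \<open>'k\<close> is a carrier set with the addition of its type and a scalar
  multiplication \<open>sc\<close>. A function \<open>W \<rightarrow> 'k\<close> is represented by a total function that vanishes
  outside \<open>W\<close>, so that equality of functions on \<open>W\<close> is equality in HOL.
\<close>

definition restrict0 :: "'w set \<Rightarrow> ('w \<Rightarrow> 'k::zero) \<Rightarrow> 'w \<Rightarrow> 'k" where
  "restrict0 W f = (\<lambda>w. if w \<in> W then f w else 0)"

abbreviation fun_scale :: "'k::field \<Rightarrow> ('w \<Rightarrow> 'k) \<Rightarrow> 'w \<Rightarrow> 'k" where
  "fun_scale c f \<equiv> (\<lambda>w. c * f w)"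

interpretation fun_space: vector_space "fun_scale :: 'k::field \<Rightarrow> ('w \<Rightarrow> 'k) \<Rightarrow> 'w \<Rightarrow> 'k"
  by unfold_locales (auto simp: fun_eq_iff algebra_simps)

definition dual_space :: "('k::field \<Rightarrow> 'w::plus \<Rightarrow> 'w) \<Rightarrow> 'w set \<Rightarrow> ('w \<Rightarrow> 'k) set" where
  "dual_space sc W = {f. (\<forall>x\<in>W. \<forall>y\<in>W. f (x + y) = f x + f y) \<and>
                         (\<forall>c. \<forall>x\<in>W. f (sc c x) = c * f x) \<and> (\<forall>x. x \<notin> W \<longrightarrow> f x = 0)}"

text \<open>
  \<open>k[W]\<^sub>d = S\<^sup>d(W\<^sup>*)\<close>, as functions: the linear span of the products of \<open>d\<close> linear forms. For an
  infinite field, polynomials and polynomial functions agree.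
\<close>

definition hom_poly_funs ::
    "('k::field \<Rightarrow> 'w::plus \<Rightarrow> 'w) \<Rightarrow> 'w set \<Rightarrow> nat \<Rightarrow> ('w \<Rightarrow> 'k) set" where
  "hom_poly_funs sc W d =
     fun_space.span {restrict0 W (\<lambda>w. \<Prod>i<d. f i w) | f. \<forall>i<d. f i \<in> dual_space sc W}"

definition poly_funs :: "('k::field \<Rightarrow> 'w::plus \<Rightarrow> 'w) \<Rightarrow> 'w set \<Rightarrow> ('w \<Rightarrow> 'k) set" where
  "poly_funs sc W = fun_space.span (\<Union>d. hom_poly_funs sc W d)"


section \<open>Tuples of vectors\<close>

text \<open>
  \<open>V\<^sup>\<oplus>\<^sup>n\<close> is \<open>carrier_vec n :: 'v vec set\<close>, where \<open>V\<close> is the type \<open>'v\<close> with scalar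
  multiplication \<open>scale\<close>. The scalar multiplication of the theory of matrices is only available
  for vectors with entries in the field.
\<close>

definition tuple_scale :: "('k \<Rightarrow> 'v \<Rightarrow> 'v) \<Rightarrow> 'k \<Rightarrow> 'v vec \<Rightarrow> 'v vec" where
  "tuple_scale scale c x = map_vec (scale c) x"

abbreviation kV_hom ::
    "('k::field \<Rightarrow> 'v::ab_group_add \<Rightarrow> 'v) \<Rightarrow> nat \<Rightarrow> nat \<Rightarrow> ('v vec \<Rightarrow> 'k) set" where
  "kV_hom scale n d \<equiv> hom_poly_funs (tuple_scale scale) (carrier_vec n) d"

abbreviation kV ::
    "('k::field \<Rightarrow> 'v::ab_group_add \<Rightarrow> 'v) \<Rightarrow> nat \<Rightarrow> ('v vec \<Rightarrow> 'k) set" where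
  "kV scale n \<equiv> poly_funs (tuple_scale scale) (carrier_vec n)"

text \<open>
  For \<open>m \<le> n\<close>: pullback of functions along the projection \<open>V\<^sup>\<oplus>\<^sup>n \<rightarrow> V\<^sup>\<oplus>\<^sup>m\<close> that forgets the last
  \<open>n - m\<close> components.
\<close>

definition pullback :: "nat \<Rightarrow> nat \<Rightarrow> ('v vec \<Rightarrow> 'k::field) \<Rightarrow> 'v vec \<Rightarrow> 'k" where
  "pullback m n f = restrict0 (carrier_vec n) (\<lambda>x. f (vec_first x m))"


section \<open>The action of the general linear group\<close>

definition GL :: "nat \<Rightarrow> 'k::field mat monoid" where
  "GL n = units_of (ring_mat TYPE('k) n ())"

text \<open>On \<open>V \<otimes> k\<^sup>n\<close>, the matrix \<open>g\<close> acts by \<open>v \<otimes> e\<^sub>j \<mapsto> (\<Sum>i. g\<^sub>i\<^sub>j v \<otimes> e\<^sub>i)\<close>.\<close>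

definition tuple_act ::
    "('k::field \<Rightarrow> 'v::ab_group_add \<Rightarrow> 'v) \<Rightarrow> nat \<Rightarrow> 'k mat \<Rightarrow> 'v vec \<Rightarrow> 'v vec" where
  "tuple_act scale n g x = vec n (\<lambda>i. \<Sum>j<n. scale (g $$ (i, j)) (x $ j))"

definition fun_act ::
    "('k::field \<Rightarrow> 'v::ab_group_add \<Rightarrow> 'v) \<Rightarrow> nat \<Rightarrow> 'k mat \<Rightarrow> ('v vec \<Rightarrow> 'k) \<Rightarrow> 'v vec \<Rightarrow> 'k" where
  "fun_act scale n g f =
     restrict0 (carrier_vec n) (\<lambda>x. f (tuple_act scale n (inv\<^bsub>GL n\<^esub> g) x))"

definition GL_submodule ::
    "('k::field \<Rightarrow> 'v::ab_group_add \<Rightarrow> 'v) \<Rightarrow> nat \<Rightarrow> ('v vec \<Rightarrow> 'k) set \<Rightarrow> bool" where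
  "GL_submodule scale n U \<longleftrightarrow> U \<subseteq> kV scale n \<and> fun_space.subspace U \<and>
     (\<forall>g\<in>carrier (GL n). \<forall>f\<in>U. fun_act scale n g f \<in> U)"

definition GL_span ::
    "('k::field \<Rightarrow> 'v::ab_group_add \<Rightarrow> 'v) \<Rightarrow> nat \<Rightarrow> ('v vec \<Rightarrow> 'k) set \<Rightarrow> ('v vec \<Rightarrow> 'k) set" where
  "GL_span scale n S = GL_submodule scale n hull S"

end

theory Submission
  imports Defs "Jordan_Normal_Form.Gauss_Jordan_Elimination"
    "HOL-Computational_Algebra.Polynomial"
begin

text \<open>
  Let \<open>N\<close> be a submodule containing \<open>k[V\<^sup>\<oplus>\<^sup>m]\<^sub>d\<close>. Choose \<open>m\<close> linear forms \<open>\<xi>\<^sub>i\<close> that span \<open>V\<^sup>*\<close>; this is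
  possible as \<open>\<ell> \<le> m\<close>. Then \<open>k[V\<^sup>\<oplus>\<^sup>n]\<^sub>d\<close> is spanned by products of \<open>d\<close> forms
  \<open>\<xi>\<^sub>i(c) = (x \<mapsto> \<Sum>j. c\<^sub>j \<xi>\<^sub>i(x\<^sub>j))\<close>. Let \<open>e\<^sub>i\<close> be the number of factors that belong to \<open>\<xi>\<^sub>i\<close>.

  If all \<open>e\<^sub>i < p\<close>, then by polarization it suffices to consider \<open>\<Prod>i. \<xi>\<^sub>i(c\<^sub>i)^e\<^sub>i\<close>. The \<open>m\<close> vectors \<open>c\<^sub>i\<close>
  lie in the span of the first \<open>m\<close> rows of some invertible matrix, so this product is a translate of
  an element of \<open>k[V\<^sup>\<oplus>\<^sup>m]\<^sub>d\<close>.

  Otherwise some \<open>e\<^sub>a \<ge> p\<close>, and \<open>d \<le> (p - 1) m\<close> yields some \<open>e\<^sub>b \<le> p - 2\<close>. Replacing \<open>\<xi>\<^sub>b\<close> by \<open>\<xi>\<^sub>b + s \<xi>\<^sub>a\<close> in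
  products of degree \<open>e\<^sub>a - 1\<close> in \<open>\<xi>\<^sub>a\<close> and \<open>e\<^sub>b + 1\<close> in \<open>\<xi>\<^sub>b\<close>, and taking the coefficient of \<open>s\<close>, reduces the
  claim to the degrees \<open>e\<^sub>a - 1\<close> and \<open>e\<^sub>b + 1\<close>. Since this
  changes the \<open>\<xi>\<^sub>i\<close>, the induction is on the claim for all \<open>m\<close>-tuples of linear forms at once.
\<close>

section \<open>Coefficient extraction in subspaces of functions\<close>

lemma fun_subspace_add:
  "fun_space.subspace N \<Longrightarrow> f \<in> N \<Longrightarrow> g \<in> N \<Longrightarrow> (\<lambda>x. f x + g x) \<in> N"
  using fun_space.subspace_add[of N f g] by (simp add: plus_fun_def)

lemma fun_subspace_diff:
  "fun_space.subspace N \<Longrightarrow> f \<in> N \<Longrightarrow> g \<in> N \<Longrightarrow> (\<lambda>x. f x - g x) \<in> N"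
  using fun_space.subspace_diff[of N f g] by (simp add: fun_diff_def)

lemma fun_subspace_cancel:
  assumes "fun_space.subspace N" "(\<lambda>x. c * f x) \<in> N" "c \<noteq> (0 :: 'k::field)"
  shows "f \<in> N"
  using fun_space.subspace_scale[OF assms(1,2), of "inverse c"] assms(3)
  by (simp add: mult.assoc[symmetric])

text \<open>The product of the nonzero polynomials \<open>monom 1 j - monom 1 D\<close> has finitely
  many roots, so an infinite field contains a non-root.\<close>

lemma exists_distinct_power:
  assumes "infinite (UNIV :: 'k::field set)"
  shows "\<exists>t :: 'k. \<forall>j<D. t ^ j \<noteq> t ^ D"
proof -
  define q where "q = (\<Prod>j<D. monom (1 :: 'k) j - monom 1 D)"
  have "monom (1 :: 'k) j - monom 1 D \<noteq> 0" if "j < D" for j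
  proof
    assume "monom (1 :: 'k) j - monom 1 D = 0"
    then have "coeff (monom (1 :: 'k) j - monom 1 D) D = 0" by simp
    with that show False by simp
  qed
  then have "q \<noteq> 0" by (auto simp: q_def prod_zero_iff)
  then have "finite {t. poly q t = 0}" by (rule poly_roots_finite)
  with assms have "{t. poly q t = 0} \<noteq> UNIV" by metis
  then obtain t where "poly q t \<noteq> 0" by auto
  then show ?thesis by (auto simp: q_def poly_prod poly_monom intro!: exI[of _ t])
qed

text \<open>
  Comparing the values at \<open>t s\<close> and \<open>s\<close>, where \<open>t\<close> has distinct powers, eliminates the leading
  coefficient.
\<close>

lemma fun_subspace_coefficients:
  fixes N :: "('w \<Rightarrow> 'k::field) set"
  assumes "infinite (UNIV :: 'k set)" and N: "fun_space.subspace N"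
    and "\<And>s. (\<lambda>x. \<Sum>j\<le>D. s ^ j * f j x) \<in> N" and "j \<le> D"
  shows "f j \<in> N"
  using assms(3,4)
proof (induction D arbitrary: f j)
  case 0
  from 0(1)[of 1] 0(2) show ?case by simp
next
  case (Suc D)
  obtain t :: 'k where t: "\<forall>j<Suc D. t ^ j \<noteq> t ^ Suc D"
    using exists_distinct_power[OF assms(1)] by blast
  have low: "f i \<in> N" if i: "i \<le> D" for i
  proof -
    have "(\<lambda>x. \<Sum>j\<le>D. s ^ j * ((t ^ j - t ^ Suc D) * f j x)) \<in> N" for s
      using fun_subspace_diff[OF N Suc.prems(1)[of "t * s"]
        fun_space.subspace_scale[OF N Suc.prems(1)[of s], of "t ^ Suc D"]]
      by (rule back_subst[where P = "\<lambda>f. f \<in> N"])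
        (simp add: fun_eq_iff sum_distrib_left sum_subtractf[symmetric] algebra_simps power_mult_distrib)
    from Suc.IH[OF this i] show ?thesis
      by (rule fun_subspace_cancel[OF N]) (use t i in auto)
  qed
  show ?case
  proof (cases "j \<le> D")
    case True
    then show ?thesis by (rule low)
  next
    case False
    with Suc.prems(2) have j: "j = Suc D" by simp
    have "(\<Sum>i\<le>D. f i) \<in> N"
      by (rule fun_space.subspace_sum[OF N]) (auto intro: low)
    moreover have "(\<Sum>i\<le>D. f i) = (\<lambda>x. \<Sum>i\<le>D. f i x)"
      by (induction D) (auto simp: fun_eq_iff)
    ultimately have "(\<lambda>x. \<Sum>i\<le>D. f i x) \<in> N" by simp
    from fun_subspace_diff[OF N Suc.prems(1)[of 1] this] j show ?thesis by simp
  qed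
qed

text \<open>The coefficient of \<open>s\<close> is written as a derivative at 0, so that the product
  and power rules can compute it. The degree bound is uniform in \<open>x\<close>, so finitely many
  coefficient functions suffice.\<close>

lemma fun_subspace_pderiv:
  fixes P :: "'w \<Rightarrow> 'k::field poly"
  assumes "infinite (UNIV :: 'k set)" and "fun_space.subspace N"
    and "\<And>s. (\<lambda>x. poly (P x) s) \<in> N" and "\<And>x. degree (P x) \<le> D"
  shows "(\<lambda>x. poly (pderiv (P x)) 0) \<in> N"
proof -
  \<comment> \<open>\<open>Suc D\<close> keeps index 1 in range when \<open>D = 0\<close>.\<close>
  have "(\<lambda>x. \<Sum>j\<le>Suc D. s ^ j * coeff (P x) j) \<in> N" for s
  proof -
    have "poly (P x) s = (\<Sum>j\<le>Suc D. s ^ j * coeff (P x) j)" for x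
      using assms(4)[of x] unfolding poly_altdef
      by (intro sum.mono_neutral_cong_left) (auto simp: coeff_eq_0 mult.commute)
    with assms(3)[of s] show ?thesis by simp
  qed
  from fun_subspace_coefficients[OF assms(1,2) this, of 1] show ?thesis
    by (simp add: poly_0_coeff_0 coeff_pderiv)
qed

section \<open>Polarization\<close>

text \<open>That \<open>fact e\<close> is nonzero in the field expresses \<open>e < p\<close>
  uniformly, including the case of infinite p.\<close>

lemma fact_nonzero_imp_of_nat_nonzero:
  assumes "of_nat (fact e) \<noteq> (0 :: 'k::field)" "0 < j" "j \<le> e"
  shows "of_nat j \<noteq> (0 :: 'k)"
proof -
  have "j dvd (fact e :: nat)" using assms by (simp add: dvd_fact)
  then show ?thesis using assms(1) by (auto elim!: dvdE)
qed

text \<open>The coefficient of \<open>s\<close> in \<open>(w + s z)^(k+1)\<close> is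
  \<open>(k+1) w^k z\<close>, and \<open>k+1 \<le> e\<close> is invertible; this trades one power of
  \<open>w\<close> for a factor \<open>z\<close>. The cofactor \<open>g\<close> holds the factors
  that are not polarized.\<close>

lemma polarization:
  fixes N :: "('w \<Rightarrow> 'k::field) set"
  assumes inf: "infinite (UNIV :: 'k set)" and N: "fun_space.subspace N"
    and W: "fun_space.subspace W"
    and e: "of_nat (fact e) \<noteq> (0 :: 'k)"
    and pow: "\<And>w. w \<in> W \<Longrightarrow> (\<lambda>x. w x ^ e * g x) \<in> N"
    and zs: "length zs = e" "set zs \<subseteq> W"
  shows "(\<lambda>x. (\<Prod>z\<leftarrow>zs. z x) * g x) \<in> N"
proof -
  \<comment> \<open>\<open>k\<close> powers of \<open>w\<close> are still to be traded. The lemma is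
    the case \<open>k = 0\<close>, with \<open>w = 0\<close> as some element of
    \<open>W\<close>.\<close>
  have "(\<lambda>x. (\<Prod>z\<leftarrow>zs. z x) * w x ^ k * g x) \<in> N"
    if "length zs + k = e" "set zs \<subseteq> W" "w \<in> W" for zs w k
    using that
  proof (induction zs arbitrary: w k)
    case Nil
    then show ?case using pow by simp
  next
    case (Cons z zs)
    let ?P = "\<lambda>x. [:(\<Prod>z\<leftarrow>zs. z x) * g x:] * [:w x, z x:] ^ Suc k"
    have "(\<lambda>x. poly (?P x) s) \<in> N" for s
    proof -
      have "(\<lambda>x. w x + s * z x) \<in> W"
        using Cons.prems fun_subspace_add[OF W _ fun_space.subspace_scale[OF W]] by auto
      from Cons.IH[of "Suc k", OF _ _ this] Cons.prems show ?thesis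
        by (simp add: poly_power algebra_simps)
    qed
    moreover have "degree (?P x) \<le> Suc k" for x
      by (rule order.trans[OF degree_mult_le])
        (use degree_power_le[of "[:w x, z x:]" "Suc k"] in \<open>auto intro: order.trans split: if_splits\<close>)
    ultimately have "(\<lambda>x. poly (pderiv (?P x)) 0) \<in> N"
      by (rule fun_subspace_pderiv[OF inf N])
    moreover have "poly (pderiv (?P x)) 0 = of_nat (Suc k) * ((\<Prod>z\<leftarrow>z # zs. z x) * w x ^ k * g x)" for x
      unfolding pderiv_mult pderiv_power_Suc by (simp add: pderiv_pCons poly_power algebra_simps)
    ultimately show ?case
      using fun_subspace_cancel[OF N, of "of_nat (Suc k)"]
        fact_nonzero_imp_of_nat_nonzero[OF e, of "Suc k"] Cons.prems(1) by simp
  qed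
  from this[of zs 0 0] zs show ?thesis
    using fun_space.subspace_0[OF W] by simp
qed

section \<open>Products of linear forms on tuples\<close>

text \<open>For linear \<open>\<xi>\<close> this is the pure tensor of \<open>\<xi>\<close> and
  \<open>c\<close> in the dual of \<open>V \<otimes> k^n\<close>.\<close>

definition form :: "nat \<Rightarrow> ('v \<Rightarrow> 'k::field) \<Rightarrow> (nat \<Rightarrow> 'k) \<Rightarrow> 'v vec \<Rightarrow> 'k" where
  "form n \<xi> c x = (\<Sum>j<n. c j * \<xi> (x $ j))"

definition form_prods :: "nat \<Rightarrow> ('v \<Rightarrow> 'k::field) \<Rightarrow> nat \<Rightarrow> ('v vec \<Rightarrow> 'k) set" where
  "form_prods n \<xi> e = {\<lambda>x. \<Prod>z\<leftarrow>zs. z x | zs. set zs \<subseteq> range (form n \<xi>) \<and> length zs = e}"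

lemma subspace_range_form: "fun_space.subspace (range (form n \<xi>))"
proof (rule fun_space.subspaceI)
  show "0 \<in> range (form n \<xi>)"
    by (rule range_eqI[of _ _ "\<lambda>_. 0"]) (simp add: form_def fun_eq_iff)
  show "f + g \<in> range (form n \<xi>)" if "f \<in> range (form n \<xi>)" "g \<in> range (form n \<xi>)" for f g
  proof -
    from that obtain c c' where "f = form n \<xi> c" "g = form n \<xi> c'" by auto
    then show ?thesis
      by (intro range_eqI[of _ _ "\<lambda>j. c j + c' j"])
        (simp add: form_def fun_eq_iff algebra_simps sum.distrib)
  qed
  show "fun_scale s f \<in> range (form n \<xi>)" if "f \<in> range (form n \<xi>)" for s f
  proof -
    from that obtain c where "f = form n \<xi> c" by auto
    then show ?thesis
      by (intro range_eqI[of _ _ "\<lambda>j. s * c j"])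
        (simp add: form_def fun_eq_iff algebra_simps sum_distrib_left)
  qed
qed

lemma form_add_scale: "form n (\<lambda>v. \<xi> v + s * \<eta> v) c x = form n \<xi> c x + s * form n \<eta> c x"
  by (simp add: form_def algebra_simps sum.distrib sum_distrib_left)

lemma form_power_in_prods: "(\<lambda>x. form n \<xi> c x ^ e) \<in> form_prods n \<xi> e"
  unfolding form_prods_def
  by (rule CollectI, rule exI[of _ "replicate e (form n \<xi> c)"]) auto

lemma form_prods_mult:
  assumes "f \<in> form_prods n \<xi> a" "g \<in> form_prods n \<xi> b"
  shows "(\<lambda>x. f x * g x) \<in> form_prods n \<xi> (a + b)"
proof -
  from assms obtain ys zs where "f = (\<lambda>x. \<Prod>z\<leftarrow>ys. z x)" "g = (\<lambda>x. \<Prod>z\<leftarrow>zs. z x)"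
    "set ys \<subseteq> range (form n \<xi>)" "length ys = a" "set zs \<subseteq> range (form n \<xi>)" "length zs = b"
    unfolding form_prods_def by auto
  then show ?thesis unfolding form_prods_def
    by (intro CollectI exI[of _ "ys @ zs"]) auto
qed

lemma form_prods_split:
  assumes "f \<in> form_prods n \<xi> (a + b)"
  obtains g h where "g \<in> form_prods n \<xi> a" "h \<in> form_prods n \<xi> b" "f = (\<lambda>x. g x * h x)"
proof -
  from assms obtain zs where zs: "f = (\<lambda>x. \<Prod>z\<leftarrow>zs. z x)" "set zs \<subseteq> range (form n \<xi>)" "length zs = a + b"
    unfolding form_prods_def by auto
  show ?thesis
  proof (rule that)
    show "(\<lambda>x. \<Prod>z\<leftarrow>take a zs. z x) \<in> form_prods n \<xi> a"
      unfolding form_prods_def using zs(2,3) set_take_subset[of a zs] by fastforce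
    show "(\<lambda>x. \<Prod>z\<leftarrow>drop a zs. z x) \<in> form_prods n \<xi> b"
      unfolding form_prods_def using zs(2,3) set_drop_subset[of a zs] by fastforce
    show "f = (\<lambda>x. (\<Prod>z\<leftarrow>take a zs. z x) * (\<Prod>z\<leftarrow>drop a zs. z x))"
      unfolding zs(1) by (simp flip: prod_list.append map_append)
  qed
qed

lemma form_prods_polarize:
  fixes N :: "('v vec \<Rightarrow> 'k::field) set"
  assumes "infinite (UNIV :: 'k set)" and "fun_space.subspace N"
    and "of_nat (fact e) \<noteq> (0 :: 'k)"
    and "\<And>c. (\<lambda>x. form n \<xi> c x ^ e * g x) \<in> N" and "f \<in> form_prods n \<xi> e"
  shows "(\<lambda>x. f x * g x) \<in> N"
proof -
  from assms(5) obtain zs where "f = (\<lambda>x. \<Prod>z\<leftarrow>zs. z x)"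
    "set zs \<subseteq> range (form n \<xi>)" "length zs = e"
    unfolding form_prods_def by auto
  with polarization[OF assms(1,2) subspace_range_form assms(3)] assms(4) show ?thesis
    by blast
qed

section \<open>Transfer of one degree between two linear forms\<close>

text \<open>
  With \<open>X\<^sub>i = \<xi>(u)\<^bsup>\<beta>+1-i\<^esup> \<eta>(u)\<^bsup>i\<^esup> \<eta>(w)\<^bsup>\<beta>-i\<^esup> \<xi>(w)\<^bsup>i\<^esup>\<close>, the substitution of \<open>\<eta> + s \<xi>\<close> for \<open>\<eta>\<close> in
  products of degree \<open>\<beta> + 1\<close> in \<open>\<eta>\<close> gives \<open>(i+1) X\<^sub>i + (\<beta>-i) X\<^sub>i\<^sub>+\<^sub>1 \<in> N\<close> as the coefficient of \<open>s\<close>.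
  By descending induction on \<open>i\<close> all \<open>X\<^sub>i\<close> are in \<open>N\<close>.
\<close>

lemma move_degree:
  fixes N :: "('v vec \<Rightarrow> 'k::field) set"
  assumes inf: "infinite (UNIV :: 'k set)" and N: "fun_space.subspace N"
    and fact: "of_nat (fact (Suc \<beta>)) \<noteq> (0 :: 'k)" and le: "\<beta> \<le> \<alpha>"
    and E: "\<And>\<xi> \<eta> s. \<xi> \<in> E \<Longrightarrow> \<eta> \<in> E \<Longrightarrow> (\<lambda>v. \<xi> v + s * \<eta> v) \<in> E"
    and in_N: "\<And>\<xi> \<eta> f h. \<xi> \<in> E \<Longrightarrow> \<eta> \<in> E \<Longrightarrow> f \<in> form_prods n \<xi> \<alpha> \<Longrightarrow> h \<in> form_prods n \<eta> (Suc \<beta>)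
      \<Longrightarrow> (\<lambda>x. f x * h x * g x) \<in> N"
    and "\<xi> \<in> E" "\<eta> \<in> E" and f: "f \<in> form_prods n \<xi> (Suc \<alpha>)" and h: "h \<in> form_prods n \<eta> \<beta>"
  shows "(\<lambda>x. f x * h x * g x) \<in> N"
proof -
  \<comment> \<open>\<open>Suc \<alpha>\<close> may be at least p, so \<open>f\<close> cannot be
    polarized as a whole. Only \<open>Suc \<beta>\<close> of its factors are; the other
    \<open>\<alpha> - \<beta>\<close> join the cofactor.\<close>
  have "f \<in> form_prods n \<xi> (Suc \<beta> + (\<alpha> - \<beta>))" using f le by simp
  then obtain f1 f2 where f1: "f1 \<in> form_prods n \<xi> (Suc \<beta>)" and f2: "f2 \<in> form_prods n \<xi> (\<alpha> - \<beta>)"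
    and f_eq: "f = (\<lambda>x. f1 x * f2 x)"
    by (rule form_prods_split)
  have powers: "(\<lambda>x. form n \<xi> u x ^ Suc \<beta> * (form n \<eta> w x ^ \<beta> * (f2 x * g x))) \<in> N" for u w
  proof -
    define X where "X i x = form n \<xi> u x ^ (Suc \<beta> - i) * form n \<eta> u x ^ i *
      form n \<eta> w x ^ (\<beta> - i) * form n \<xi> w x ^ i * (f2 x * g x)" for i x
    have step: "(\<lambda>x. of_nat (Suc i) * X i x + of_nat (\<beta> - i) * X (Suc i) x) \<in> N" if i: "i \<le> \<beta>" for i
    proof -
      \<comment> \<open>At each \<open>s\<close>, \<open>?f\<close> has degree
        \<open>\<alpha>\<close> in \<open>\<xi>\<close> and \<open>?h\<close> has degree
        \<open>Suc \<beta>\<close> in \<open>\<eta> + s \<xi>\<close>. Differentiating the power at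
        \<open>u\<close> gives the term in \<open>X i\<close>, that at \<open>w\<close> the term in
        \<open>X (Suc i)\<close>.\<close>
      let ?f = "\<lambda>x. form n \<xi> u x ^ (\<beta> - i) * form n \<xi> w x ^ i * f2 x"
      let ?h = "\<lambda>x. [:form n \<eta> u x, form n \<xi> u x:] ^ Suc i * [:form n \<eta> w x, form n \<xi> w x:] ^ (\<beta> - i)"
      let ?P = "\<lambda>x. [:?f x * g x:] * ?h x"
      have "?f \<in> form_prods n \<xi> (\<beta> - i + i + (\<alpha> - \<beta>))"
        by (intro form_prods_mult form_power_in_prods f2)
      with i le have f: "?f \<in> form_prods n \<xi> \<alpha>" by simp
      have "(\<lambda>x. poly (?P x) s) \<in> N" for s
      proof -
        let ?\<eta> = "\<lambda>v. \<eta> v + s * \<xi> v"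
        have "(\<lambda>x. form n ?\<eta> u x ^ Suc i * form n ?\<eta> w x ^ (\<beta> - i)) \<in> form_prods n ?\<eta> (Suc i + (\<beta> - i))"
          by (intro form_prods_mult form_power_in_prods)
        with i have h: "(\<lambda>x. form n ?\<eta> u x ^ Suc i * form n ?\<eta> w x ^ (\<beta> - i)) \<in> form_prods n ?\<eta> (Suc \<beta>)"
          by simp
        from in_N[OF \<open>\<xi> \<in> E\<close> E[OF \<open>\<eta> \<in> E\<close> \<open>\<xi> \<in> E\<close>] f h] show ?thesis
          by (simp add: form_add_scale mult_ac del: power_Suc)
      qed
      moreover have "degree (?P x) \<le> Suc i + (\<beta> - i)" for x
      proof -
        have "degree ([:a, b:] ^ k) \<le> k" for a b :: 'k and k
          using degree_power_le[of "[:a, b:]" k] by (auto split: if_splits)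
        then have "degree (?h x) \<le> Suc i + (\<beta> - i)"
          by (intro order.trans[OF degree_mult_le] add_mono)
        then show ?thesis by (intro order.trans[OF degree_mult_le]) simp
      qed
      ultimately have "(\<lambda>x. poly (pderiv (?P x)) 0) \<in> N"
        by (rule fun_subspace_pderiv[OF inf N])
      moreover have "poly (pderiv (?P x)) 0 = of_nat (Suc i) * X i x + of_nat (\<beta> - i) * X (Suc i) x" for x
      proof (cases "i = \<beta>")
        case True
        then show ?thesis
          unfolding X_def pderiv_mult pderiv_power_Suc by (simp add: pderiv_pCons algebra_simps)
      next
        case False
        with i obtain j where "\<beta> = Suc (i + j)" by (auto simp: le_less dest: less_imp_Suc_add)
        then have j: "\<beta> - i = Suc j" "\<beta> - Suc i = j" "Suc \<beta> - i = Suc (Suc j)" by auto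
        show ?thesis
          unfolding X_def j diff_Suc_Suc pderiv_mult pderiv_power_Suc
          by (simp add: pderiv_pCons algebra_simps)
      qed
      ultimately show ?thesis by simp
    qed
    have "X (\<beta> - k) \<in> N" if "k \<le> \<beta>" for k
      using that
    proof (induction k)
      case 0
      \<comment> \<open>At \<open>i = \<beta>\<close> the second term of \<open>step\<close>
        vanishes, which starts the descent.\<close>
      have "(\<lambda>x. of_nat (Suc \<beta>) * X \<beta> x) \<in> N" using step[of \<beta>] by simp
      then show ?case
        using fun_subspace_cancel[OF N] fact_nonzero_imp_of_nat_nonzero[OF fact, of "Suc \<beta>"] by simp
    next
      case (Suc k)
      let ?i = "\<beta> - Suc k"
      from Suc have "X (Suc ?i) \<in> N" by (simp add: Suc_diff_Suc)
      from fun_subspace_diff[OF N step[of ?i] fun_space.subspace_scale[OF N this, of "of_nat (\<beta> - ?i)"]]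
      have "(\<lambda>x. of_nat (Suc ?i) * X ?i x) \<in> N" by simp
      then show ?case
        by (rule fun_subspace_cancel[OF N])
          (use fact_nonzero_imp_of_nat_nonzero[OF fact, of "Suc ?i"] in simp)
    qed
    from this[of \<beta>] show ?thesis by (simp add: X_def[abs_def] mult.assoc)
  qed
  have "(\<lambda>x. f1 x * (h x * (f2 x * g x))) \<in> N"
  proof (rule form_prods_polarize[OF inf N fact _ f1])
    fix u
    have "of_nat (fact \<beta>) \<noteq> (0 :: 'k)"
    proof
      assume "of_nat (fact \<beta>) = (0 :: 'k)"
      with fact show False by (simp add: fact_Suc)
    qed
    moreover have "(\<lambda>x. form n \<eta> w x ^ \<beta> * (form n \<xi> u x ^ Suc \<beta> * (f2 x * g x))) \<in> N" for w
      using powers[of u w] by (simp add: mult_ac)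
    ultimately have "(\<lambda>x. h x * (form n \<xi> u x ^ Suc \<beta> * (f2 x * g x))) \<in> N"
      by (rule form_prods_polarize[OF inf N _ _ h])
    then show "(\<lambda>x. form n \<xi> u x ^ Suc \<beta> * (h x * (f2 x * g x))) \<in> N"
      by (simp add: mult_ac)
  qed
  then show ?thesis by (simp add: f_eq mult_ac)
qed

section \<open>Reduction to products of powers, one for each row\<close>

lemma polarize_rows:
  fixes N :: "('v vec \<Rightarrow> 'k::field) set" and m :: nat
  assumes inf: "infinite (UNIV :: 'k set)" and N: "fun_space.subspace N"
    and fact: "\<And>i. i < m \<Longrightarrow> of_nat (fact (e i)) \<noteq> (0 :: 'k)"
    and powers: "\<And>c. (\<lambda>x. \<Prod>i<m. form n (\<xi> i) (c i) x ^ e i) \<in> N"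
    and f: "\<And>i. i < m \<Longrightarrow> f i \<in> form_prods n (\<xi> i) (e i)"
  shows "(\<lambda>x. \<Prod>i<m. f i x) \<in> N"
proof -
  \<comment> \<open>The first \<open>k\<close> rows are general, the others still powers;
    \<open>c\<close> is arbitrary so that its entry \<open>k\<close> can vary in the
    polarization.\<close>
  have "(\<lambda>x. (\<Prod>i<k. f i x) * (\<Prod>i\<in>{k..<m}. form n (\<xi> i) (c i) x ^ e i)) \<in> N" if "k \<le> m" for k c
    using that
  proof (induction k arbitrary: c)
    case 0
    then show ?case using powers[of c] by (simp add: atLeast0LessThan)
  next
    case (Suc k)
    let ?g = "\<lambda>x. (\<Prod>i<k. f i x) * (\<Prod>i\<in>{Suc k..<m}. form n (\<xi> i) (c i) x ^ e i)"
    have "(\<lambda>x. form n (\<xi> k) w x ^ e k * ?g x) \<in> N" for w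
    proof -
      have "{k..<m} = insert k {Suc k..<m}" using Suc.prems by auto
      moreover have "(\<Prod>i\<in>{Suc k..<m}. form n (\<xi> i) ((c(k := w)) i) x ^ e i) =
          (\<Prod>i\<in>{Suc k..<m}. form n (\<xi> i) (c i) x ^ e i)" for x
        by (rule prod.cong) auto
      ultimately show ?thesis
        using Suc.IH[of "c(k := w)"] Suc.prems by (simp add: mult_ac)
    qed
    from form_prods_polarize[OF inf N fact[of k] this f[of k]] Suc.prems show ?case
      by (simp add: mult_ac)
  qed
  from this[of m] show ?thesis by simp
qed

text \<open>\<open>E\<close> abstracts the dual space of V by the closure property that the degree
  transfer needs.\<close>

lemma balance_rows:
  fixes N :: "('v vec \<Rightarrow> 'k::field) set"
  assumes inf: "infinite (UNIV :: 'k set)" and N: "fun_space.subspace N"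
    and E: "\<And>\<xi> \<eta> s. \<xi> \<in> E \<Longrightarrow> \<eta> \<in> E \<Longrightarrow> (\<lambda>v. \<xi> v + s * \<eta> v) \<in> E"
    and powers: "\<And>\<xi> c e. (\<And>i. i < m \<Longrightarrow> \<xi> i \<in> E) \<Longrightarrow> (\<Sum>i<m. e i) = d \<Longrightarrow>
      (\<lambda>x. \<Prod>i<m. form n (\<xi> i) (c i) x ^ e i) \<in> N"
    and d: "CHAR('k) > 0 \<longrightarrow> d \<le> (CHAR('k) - 1) * m"
    and "(\<Sum>i<m. e i) = d" and "\<And>i. i < m \<Longrightarrow> \<xi> i \<in> E"
    and "\<And>i. i < m \<Longrightarrow> f i \<in> form_prods n (\<xi> i) (e i)"
  shows "(\<lambda>x. \<Prod>i<m. f i x) \<in> N"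
proof (cases "CHAR('k) = 0")
  case True
  then have "of_nat (fact k) \<noteq> (0 :: 'k)" for k
    by (simp add: of_nat_eq_0_iff_char_dvd del: of_nat_fact)
  then show ?thesis
    using assms by (intro polarize_rows[OF inf N _ _ assms(8)]) auto
next
  case False
  let ?p = "CHAR('k)"
  have p: "prime ?p" using False by (simp add: prime_CHAR_semidom)
  have fact: "of_nat (fact k) \<noteq> (0 :: 'k)" if "k < ?p" for k
    using that p by (simp add: of_nat_eq_0_iff_char_dvd prime_dvd_fact_iff del: of_nat_fact)
  show ?thesis using assms(6-8)
  \<comment> \<open>The measure is the total excess of the exponents over p - 1. A transfer from
    \<open>a\<close> to \<open>b\<close> lowers it, because \<open>e b + 1\<close> is still at most
    p - 1.\<close>
  proof (induction "\<Sum>i<m. e i - (?p - 1)" arbitrary: e \<xi> f rule: less_induct)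
    case (less e \<xi> f)
    show ?case
    proof (cases "\<forall>i<m. e i < ?p")
      case True
      then show ?thesis
        using fact powers less.prems by (intro polarize_rows[OF inf N _ _ less.prems(3)]) auto
    next
      case False
      then obtain a where a: "a < m" "e a \<ge> ?p" by force
      \<comment> \<open>Pigeonhole: were all exponents at least p - 1, the one at \<open>a\<close>,
        being at least p, would push the sum above (p - 1) m.\<close>
      have "\<exists>b<m. e b < ?p - 1"
      proof (rule ccontr)
        assume "\<not> (\<exists>b<m. e b < ?p - 1)"
        then have "?p - 1 \<le> e b" if "b < m" for b using that not_less by blast
        then have "(\<Sum>i<m. ?p - 1) < (\<Sum>i<m. e i)"
          using a prime_gt_0_nat[OF p] by (intro sum_strict_mono_ex1) (auto intro!: bexI[of _ a])
        with less.prems(1) d p show False by (simp add: mult.commute prime_gt_0_nat)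
      qed
      then obtain b where b: "b < m" "e b < ?p - 1" by blast
      have ab: "a \<noteq> b" using a b by auto
      define e' where "e' = e(a := e a - 1, b := Suc (e b))"
      define I where "I = {..<m} - {a, b}"
      have I: "{..<m} = insert a (insert b I)" "finite I" "a \<notin> insert b I" "b \<notin> I"
        using a b ab by (auto simp: I_def)
      have split: "(\<Sum>i<m. q i) = q a + (q b + (\<Sum>i\<in>I. q i))" for q :: "nat \<Rightarrow> nat"
        using I by simp
      have psplit: "(\<Prod>i<m. q i) = q a * q b * (\<Prod>i\<in>I. q i)" for q :: "nat \<Rightarrow> 'k"
        using I by (simp add: mult.assoc)
      have e'_I: "(\<Sum>i\<in>I. q (e' i)) = (\<Sum>i\<in>I. q (e i))" for q :: "nat \<Rightarrow> nat"
        by (rule sum.cong) (auto simp: e'_def I_def)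
      have "(\<Sum>i<m. e' i - (?p - 1)) < (\<Sum>i<m. e i - (?p - 1))"
        unfolding split e'_I[of "\<lambda>k. k - (?p - 1)"] using a b ab prime_gt_0_nat[OF p] by (simp add: e'_def)
      moreover have "(\<Sum>i<m. e' i) = d"
        using less.prems(1) unfolding split e'_I[of "\<lambda>x. x"] using a ab prime_gt_0_nat[OF p]
        by (simp add: e'_def)
      ultimately have IH: "(\<lambda>x. \<Prod>i<m. f' i x) \<in> N"
        if "\<And>i. i < m \<Longrightarrow> \<xi>' i \<in> E" "\<And>i. i < m \<Longrightarrow> f' i \<in> form_prods n (\<xi>' i) (e' i)" for \<xi>' f'
        using less.hyps that by blast
      have "(\<lambda>x. f a x * f b x * (\<Prod>i\<in>I. f i x)) \<in> N"
      proof (rule move_degree[OF inf N, where E = E and \<beta> = "e b" and \<alpha> = "e a - 1"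
            and \<xi> = "\<xi> a" and \<eta> = "\<xi> b" and n = n])
        show "of_nat (fact (Suc (e b))) \<noteq> (0 :: 'k)" by (rule fact) (use b in simp)
        show "e b \<le> e a - 1" using a b by simp
        \<comment> \<open>The transfer needs this for all forms in rows \<open>a\<close> and
          \<open>b\<close>, hence the induction hypothesis for changed \<open>\<xi>\<close>. The
          remaining rows are the cofactor.\<close>
        show "(\<lambda>x. g x * h x * (\<Prod>i\<in>I. f i x)) \<in> N"
          if "\<zeta> \<in> E" "\<eta> \<in> E" "g \<in> form_prods n \<zeta> (e a - 1)" "h \<in> form_prods n \<eta> (Suc (e b))"
          for \<zeta> \<eta> g h
        proof -
          have "(\<lambda>x. \<Prod>i<m. (f(a := g, b := h)) i x) \<in> N"
            by (rule IH[of "\<xi>(a := \<zeta>, b := \<eta>)"]) (use that ab less.prems in \<open>auto simp: e'_def\<close>)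
          moreover have "(\<Prod>i\<in>I. (f(a := g, b := h)) i x) = (\<Prod>i\<in>I. f i x)" for x
            by (rule prod.cong) (auto simp: I_def)
          ultimately show ?thesis using ab by (simp add: psplit)
        qed
        show "f a \<in> form_prods n (\<xi> a) (Suc (e a - 1))"
          using less.prems(3)[of a] a prime_gt_0_nat[OF p] by simp
      qed (use E less.prems a b in auto)
      then show ?thesis by (simp add: psplit)
    qed
  qed
qed

section \<open>Homogeneous polynomial functions under linear maps\<close>

lemma restrict0_eqI: "(\<And>x. x \<in> W \<Longrightarrow> f x = g x) \<Longrightarrow> restrict0 W f = restrict0 W g"
  by (auto simp: restrict0_def)

lemma subspace_hom_poly_funs: "fun_space.subspace (hom_poly_funs sc W d)"
  unfolding hom_poly_funs_def by (rule fun_space.subspace_span)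

lemma hom_poly_funs_prod_list:
  assumes "\<And>z. z \<in> set zs \<Longrightarrow> restrict0 W z \<in> dual_space sc W"
  shows "restrict0 W (\<lambda>x. \<Prod>z\<leftarrow>zs. z x) \<in> hom_poly_funs sc W (length zs)"
proof -
  have "restrict0 W (\<lambda>x. \<Prod>z\<leftarrow>zs. z x) =
      restrict0 W (\<lambda>x. \<Prod>i<length zs. restrict0 W (zs ! i) x)"
    by (rule restrict0_eqI) (simp add: restrict0_def prod.list_conv_set_nth atLeast0LessThan)
  then show ?thesis
    unfolding hom_poly_funs_def using assms by (auto intro!: fun_space.span_base)
qed

lemma hom_poly_funs_prod_powers:
  fixes m :: nat
  assumes "\<And>i. i < m \<Longrightarrow> restrict0 W (z i) \<in> dual_space sc W"
  shows "restrict0 W (\<lambda>x. \<Prod>i<m. z i x ^ e i) \<in> hom_poly_funs sc W (\<Sum>i<m. e i)"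
proof -
  let ?zs = "concat (map (\<lambda>i. replicate (e i) (z i)) [0..<m])"
  have "(\<Prod>z\<leftarrow>?zs. z x) = (\<Prod>i<m. z i x ^ e i)" for x
    by (induction m) auto
  moreover have "length ?zs = (\<Sum>i<m. e i)"
    by (induction m) auto
  ultimately show ?thesis
    using hom_poly_funs_prod_list[of ?zs W sc] assms by fastforce
qed

text \<open>A linear map \<open>T\<close> pulls linear forms back to linear forms, hence products of
  \<open>d\<close> forms to such products. The projection in \<open>pullback\<close> and the action
  of a matrix are instances.\<close>

lemma hom_poly_funs_comp:
  fixes sc :: "'k::field \<Rightarrow> 'w::plus \<Rightarrow> 'w" and sc' :: "'k \<Rightarrow> 'u::plus \<Rightarrow> 'u"
  assumes T: "\<And>x. x \<in> W' \<Longrightarrow> T x \<in> W"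
    and add: "\<And>x y. x \<in> W' \<Longrightarrow> y \<in> W' \<Longrightarrow> T (x + y) = T x + T y"
    and scale: "\<And>c x. x \<in> W' \<Longrightarrow> T (sc' c x) = sc c (T x)"
    and W': "\<And>x y. x \<in> W' \<Longrightarrow> y \<in> W' \<Longrightarrow> x + y \<in> W'" "\<And>c x. x \<in> W' \<Longrightarrow> sc' c x \<in> W'"
    and "f \<in> hom_poly_funs sc W d"
  shows "restrict0 W' (\<lambda>x. f (T x)) \<in> hom_poly_funs sc' W' d"
  using assms(6) unfolding hom_poly_funs_def[of sc]
proof (induction rule: fun_space.span_induct_alt)
  case base
  have "restrict0 W' (\<lambda>x. (0 :: 'w \<Rightarrow> 'k) (T x)) = 0"
    by (auto simp: restrict0_def)
  then show ?case
    using fun_space.subspace_0[OF subspace_hom_poly_funs] by metis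
next
  case (step c f g)
  then obtain z where f: "f = restrict0 W (\<lambda>w. \<Prod>i<d. z i w)" and z: "\<forall>i<d. z i \<in> dual_space sc W"
    by auto
  let ?z = "\<lambda>i. restrict0 W' (\<lambda>x. z i (T x))"
  have "?z i \<in> dual_space sc' W'" if "i < d" for i
    using z that T add scale W' by (auto simp: dual_space_def restrict0_def)
  then have "restrict0 W' (\<lambda>x. \<Prod>i<d. ?z i x) \<in> hom_poly_funs sc' W' d"
    unfolding hom_poly_funs_def by (intro fun_space.span_base) auto
  moreover have "restrict0 W' (\<lambda>x. \<Prod>i<d. ?z i x) = restrict0 W' (\<lambda>x. f (T x))"
    using T by (intro restrict0_eqI) (simp add: f restrict0_def)
  ultimately have "fun_scale c (restrict0 W' (\<lambda>x. f (T x))) + restrict0 W' (\<lambda>x. g (T x))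
      \<in> hom_poly_funs sc' W' d"
    using step.IH subspace_hom_poly_funs
    by (auto intro!: fun_space.subspace_add fun_space.subspace_scale)
  moreover have "fun_scale c (restrict0 W' (\<lambda>x. f (T x))) + restrict0 W' (\<lambda>x. g (T x)) =
      restrict0 W' (\<lambda>x. (fun_scale c f + g) (T x))"
    by (auto simp: restrict0_def)
  ultimately show ?case by simp
qed

lemma pullback_hom_poly_funs:
  fixes scale :: "'k::field \<Rightarrow> 'v::ab_group_add \<Rightarrow> 'v"
  assumes "m \<le> n" and "f \<in> kV_hom scale m d"
  shows "pullback m n f \<in> kV_hom scale n d"
  unfolding pullback_def
  by (rule hom_poly_funs_comp[OF _ _ _ _ _ assms(2)])
    (use assms(1) in \<open>auto simp: vec_first_def tuple_scale_def intro!: eq_vecI\<close>)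

lemma (in vector_space) fun_act_hom_poly_funs:
  assumes "f \<in> kV_hom scale n d"
  shows "fun_act scale n g f \<in> kV_hom scale n d"
  unfolding fun_act_def
  by (rule hom_poly_funs_comp[OF _ _ _ _ _ assms])
    (auto simp: tuple_act_def tuple_scale_def scale_right_distrib sum.distrib scale_sum_right
      scale_left_commute mult.commute intro!: eq_vecI)

lemma (in vector_space) GL_submodule_kV_hom: "GL_submodule scale n (kV_hom scale n d)"
  unfolding GL_submodule_def poly_funs_def
  using fun_act_hom_poly_funs subspace_hom_poly_funs by (auto intro: fun_space.span_base)

section \<open>Linear forms on V and on tuples\<close>

lemma dual_space_UNIV_add_scale:
  fixes scale :: "'k::field \<Rightarrow> 'v::ab_group_add \<Rightarrow> 'v"
  shows "\<xi> \<in> dual_space scale UNIV \<Longrightarrow> \<eta> \<in> dual_space scale UNIV \<Longrightarrow>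
    (\<lambda>v. \<xi> v + s * \<eta> v) \<in> dual_space scale UNIV"
  by (auto simp: dual_space_def algebra_simps)

lemma (in vector_space) dual_space_sum:
  assumes "\<xi> \<in> dual_space scale UNIV"
  shows "\<xi> (\<Sum>i\<in>I. scale (c i) (v i)) = (\<Sum>i\<in>I. c i * \<xi> (v i))"
proof -
  have "\<xi> (scale 0 0) = 0 * \<xi> 0"
    using assms by (simp add: dual_space_def del: scale_zero_left scale_zero_right mult_zero_left)
  then have "\<xi> 0 = 0" by simp
  then show ?thesis
    using assms by (induction I rule: infinite_finite_induct) (auto simp: dual_space_def)
qed

lemma form_in_dual_space:
  fixes scale :: "'k::field \<Rightarrow> 'v::ab_group_add \<Rightarrow> 'v"
  assumes "\<xi> \<in> dual_space scale UNIV"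
  shows "restrict0 (carrier_vec n) (form n \<xi> c) \<in> dual_space (tuple_scale scale) (carrier_vec n)"
  using assms
  by (auto simp: dual_space_def restrict0_def form_def tuple_scale_def algebra_simps
      sum.distrib sum_distrib_left)

text \<open>Restricting \<open>f\<close> to one slot gives a linear form on V, which the dual basis
  expands. Collecting terms by \<open>b\<close> instead of by slot makes the values on
  \<open>b\<close> a coefficient vector.\<close>

lemma (in finite_dimensional_vector_space) dual_space_expansion:
  assumes f: "f \<in> dual_space (tuple_scale scale) (carrier_vec n)" and x: "x \<in> carrier_vec n"
  shows "f x = (\<Sum>b\<in>Basis. form n (\<lambda>v. representation Basis v b)
    (\<lambda>j. f (vec n (\<lambda>i. if i = j then b else 0))) x)"
proof -
  define \<phi> where "\<phi> j v = f (vec n (\<lambda>i. if i = j then v else 0))" for j v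
  have add: "f (y + z) = f y + f z" if "y \<in> carrier_vec n" "z \<in> carrier_vec n" for y z
    using f that by (auto simp: dual_space_def)
  have scale: "f (tuple_scale scale c y) = c * f y" if "y \<in> carrier_vec n" for c y
    using f that by (auto simp: dual_space_def)
  have "\<phi> j \<in> dual_space scale UNIV" for j
  proof -
    have "\<phi> j (u + v) = \<phi> j u + \<phi> j v" for u v
      unfolding \<phi>_def by (subst add[symmetric]) (auto intro!: arg_cong[where f = f] eq_vecI)
    moreover have "\<phi> j (scale c v) = c * \<phi> j v" for c v
      unfolding \<phi>_def by (subst scale[symmetric])
        (auto simp: tuple_scale_def intro!: arg_cong[where f = f] eq_vecI)
    ultimately show ?thesis by (simp add: dual_space_def)
  qed
  then have \<phi>: "\<phi> j v = (\<Sum>b\<in>Basis. representation Basis v b * \<phi> j b)" for j v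
    using dual_space_sum[of "\<phi> j" "\<lambda>b. representation Basis v b" "\<lambda>b. b" Basis]
      sum_representation_eq[OF independent_Basis _ finite_Basis order.refl, of v]
    by (simp add: span_Basis)
  have "f (vec n (\<lambda>i. if i < k then x $ i else 0)) = (\<Sum>j<k. \<phi> j (x $ j))" if "k \<le> n" for k
    using that
  proof (induction k)
    case 0
    have "vec n (\<lambda>i. 0) = tuple_scale scale 0 (vec n (\<lambda>i. 0))"
      by (auto simp: tuple_scale_def)
    with scale[of "vec n (\<lambda>i. 0)" 0] show ?case by simp
  next
    case (Suc k)
    have "vec n (\<lambda>i. if i < Suc k then x $ i else 0) =
        vec n (\<lambda>i. if i < k then x $ i else 0) + vec n (\<lambda>i. if i = k then x $ k else 0)"
      by (auto intro!: eq_vecI)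
    with Suc show ?case by (simp add: add \<phi>_def)
  qed
  moreover have "vec n (\<lambda>i. if i < n then x $ i else 0) = x"
    using x by (auto intro!: eq_vecI)
  ultimately have "f x = (\<Sum>j<n. \<phi> j (x $ j))"
    by (metis order.refl)
  also have "\<dots> = (\<Sum>j<n. \<Sum>b\<in>Basis. representation Basis (x $ j) b * \<phi> j b)"
    by (subst \<phi>) simp
  also have "\<dots> = (\<Sum>b\<in>Basis. form n (\<lambda>v. representation Basis v b) (\<lambda>j. \<phi> j b) x)"
    by (subst sum.swap) (simp add: form_def mult.commute)
  finally show ?thesis by (simp add: \<phi>_def)
qed

text \<open>Coefficient vectors transform as row vectors; forgetting components after
  \<open>h\<close> leaves only the first \<open>m\<close> rows of \<open>h\<close>.\<close>

lemma (in vector_space) form_tuple_act: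
  assumes "\<xi> \<in> dual_space scale UNIV" "m \<le> n"
  shows "form m \<xi> c (vec_first (tuple_act scale n h x) m) =
    form n \<xi> (\<lambda>j. \<Sum>k<m. c k * h $$ (k, j)) x"
proof -
  have "form m \<xi> c (vec_first (tuple_act scale n h x) m) =
      (\<Sum>k<m. \<Sum>j<n. c k * (h $$ (k, j) * \<xi> (x $ j)))"
    using assms(2) by (simp add: form_def vec_first_def tuple_act_def dual_space_sum[OF assms(1)] sum_distrib_left)
  also have "\<dots> = form n \<xi> (\<lambda>j. \<Sum>k<m. c k * h $$ (k, j)) x"
    by (subst sum.swap) (simp add: form_def sum_distrib_right mult.assoc)
  finally show ?thesis .
qed

section \<open>Invertible matrices whose first rows span given vectors\<close>

lemma group_GL: "group (GL n :: 'k::field mat monoid)"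
proof -
  interpret ring "ring_mat TYPE('k) n ()" by (rule ring_mat)
  show ?thesis unfolding GL_def by (rule units_group)
qed

text \<open>With the \<open>c i\<close> as columns of \<open>A\<close>, Gauss-Jordan elimination
  gives \<open>R = P * A\<close> in echelon form. As \<open>R\<close> has \<open>m\<close> columns,
  its rows from \<open>m\<close> on vanish. So \<open>A = Q * R\<close>, with \<open>Q\<close>
  inverse to \<open>P\<close>, involves only the first \<open>m\<close> columns of \<open>Q\<close>,
  and \<open>h\<close> is the transpose of \<open>Q\<close>.\<close>

lemma GL_rows_span:
  fixes c :: "nat \<Rightarrow> nat \<Rightarrow> 'k::field"
  assumes "m \<le> n"
  shows "\<exists>h\<in>carrier (GL n). \<exists>c'. \<forall>i<m. \<forall>j<n. c i j = (\<Sum>k<m. c' i k * h $$ (k, j))"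
proof -
  define A where "A = mat n m (\<lambda>(j, i). c i j)"
  have A: "A \<in> carrier_mat n m" by (simp add: A_def)
  obtain R B where gj: "gauss_jordan A (0\<^sub>m n 0) = (R, B)" by (cases "gauss_jordan A (0\<^sub>m n 0)")
  from gauss_jordan_transform[OF A _ gj, of 0 "()"]
  obtain P where P: "P \<in> Units (ring_mat TYPE('k) n ())" and R_eq: "R = P * A" by auto
  then obtain Q where PQ: "P \<in> carrier_mat n n" "Q \<in> carrier_mat n n" "Q * P = 1\<^sub>m n" "P * Q = 1\<^sub>m n"
    unfolding Units_def ring_mat_simps by auto
  have R: "R \<in> carrier_mat n m" using R_eq PQ A by simp
  have A_eq: "A = Q * R"
    unfolding R_eq using assoc_mult_mat[OF PQ(2,1) A] PQ(3) A by simp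
  from gauss_jordan_row_echelon[OF A gj] R obtain f where f: "pivot_fun R f m"
    unfolding row_echelon_form_def by auto
  note pivot = pivot_funD[OF _ f, of n]
  have R_0: "R $$ (k, i) = 0" if "m \<le> k" "k < n" "i < m" for k i
  proof -
    \<comment> \<open>Pivot positions grow strictly until they reach the number of columns
      \<open>m\<close>, which marks a zero row.\<close>
    from pivot_bound[OF _ f, of n 0 k] that pivot(1)[of k] R have "f k = m" by auto
    with pivot(2)[of k i] that R show ?thesis by auto
  qed
  have "c i j = (\<Sum>k<m. R $$ (k, i) * transpose_mat Q $$ (k, j))" if "i < m" "j < n" for i j
  proof -
    have "c i j = A $$ (j, i)" using that by (simp add: A_def)
    also have "\<dots> = (\<Sum>k<n. Q $$ (j, k) * R $$ (k, i))"
      unfolding A_eq using that PQ R by (simp add: scalar_prod_def atLeast0LessThan)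
    also have "\<dots> = (\<Sum>k<m. Q $$ (j, k) * R $$ (k, i))"
      using assms R_0 that by (intro sum.mono_neutral_right) auto
    also have "\<dots> = (\<Sum>k<m. R $$ (k, i) * transpose_mat Q $$ (k, j))"
      using assms that PQ by (intro sum.cong) auto
    finally show ?thesis .
  qed
  moreover have "transpose_mat Q \<in> carrier (GL n)"
  proof -
    have "transpose_mat P * transpose_mat Q = 1\<^sub>m n" "transpose_mat Q * transpose_mat P = 1\<^sub>m n"
      by (simp_all add: PQ(3,4) flip: transpose_mult[OF PQ(2,1)] transpose_mult[OF PQ(1,2)])
    then show ?thesis
      using PQ unfolding GL_def units_of_def Units_def ring_mat_simps
      by (auto intro!: bexI[of _ "transpose_mat P"])
  qed
  ultimately show ?thesis by (intro bexI[of _ "transpose_mat Q"] exI[of _ "\<lambda>i k. R $$ (k, i)"]) auto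
qed

section \<open>Multiplying out, and membership in a submodule\<close>

text \<open>Multiplying out picks one row for each factor; sorting the chosen forms by row gives row
  products with exponents of sum \<open>d\<close>.\<close>

lemma prod_of_form_sums:
  fixes N :: "('v vec \<Rightarrow> 'k::field) set" and m :: nat
  assumes N: "fun_space.subspace N"
    and rows: "\<And>e f. (\<Sum>i<m. e i) = d \<Longrightarrow> (\<And>i. i < m \<Longrightarrow> f i \<in> form_prods n (\<xi> i) (e i)) \<Longrightarrow>
      (\<lambda>x. \<Prod>i<m. f i x) \<in> N"
  shows "(\<lambda>x. \<Prod>t<d. \<Sum>i<m. form n (\<xi> i) (c t i) x) \<in> N"
proof -
  let ?F = "\<lambda>t x. \<Sum>i<m. form n (\<xi> i) (c t i) x"
  \<comment> \<open>The first \<open>k\<close> sums are unexpanded; the forms chosen from the others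
    are collected in the rows \<open>f i\<close>.\<close>
  have expand: "(\<lambda>x. (\<Prod>t<k. ?F t x) * (\<Prod>i<m. f i x)) \<in> N"
    if "k + (\<Sum>i<m. e i) = d" "\<And>i. i < m \<Longrightarrow> f i \<in> form_prods n (\<xi> i) (e i)" for k e f
    using that
  proof (induction k arbitrary: e f)
    case 0
    then show ?case using rows by simp
  next
    case (Suc k)
    let ?f = "\<lambda>j. f(j := \<lambda>x. form n (\<xi> j) (c k j) x * f j x)"
    have summand: "(\<lambda>x. (\<Prod>t<k. ?F t x) * (\<Prod>i<m. ?f j i x)) \<in> N" if j: "j < m" for j
    proof (rule Suc.IH)
      have "(\<Sum>i<m. (e(j := Suc (e j))) i) = Suc (\<Sum>i<m. e i)"
        using j by (simp add: sum.remove[of "{..<m}" j])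
      with Suc.prems(1) show "k + (\<Sum>i<m. (e(j := Suc (e j))) i) = d" by simp
      show "?f j i \<in> form_prods n (\<xi> i) ((e(j := Suc (e j))) i)" if "i < m" for i
        using form_prods_mult[OF form_power_in_prods[of n "\<xi> j" "c k j" 1] Suc.prems(2)[OF j]]
          Suc.prems(2)[OF that] by auto
    qed
    have "(\<Sum>j<m. (\<lambda>x. (\<Prod>t<k. ?F t x) * (\<Prod>i<m. ?f j i x))) \<in> N"
      by (rule fun_space.subspace_sum[OF N]) (use summand in auto)
    moreover have "(\<Sum>j<m. (\<lambda>x. (\<Prod>t<k. ?F t x) * (\<Prod>i<m. ?f j i x))) =
        (\<lambda>x. (\<Prod>t<Suc k. ?F t x) * (\<Prod>i<m. f i x))"
    proof
      fix x
      have "(\<Prod>i<m. ?f j i x) = form n (\<xi> j) (c k j) x * (\<Prod>i<m. f i x)" if "j < m" for j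
        using that by (simp add: prod.remove[of "{..<m}" j] mult.assoc)
      moreover have "(\<Sum>j\<in>J. g j) x = (\<Sum>j\<in>J. g j x)" for J and g :: "nat \<Rightarrow> 'v vec \<Rightarrow> 'k"
        by (induction J rule: infinite_finite_induct) auto
      ultimately show "(\<Sum>j<m. (\<lambda>x. (\<Prod>t<k. ?F t x) * (\<Prod>i<m. ?f j i x))) x =
          (\<Prod>t<Suc k. ?F t x) * (\<Prod>i<m. f i x)"
        by (simp add: sum_distrib_left sum_distrib_right mult_ac)
    qed
    ultimately show ?case by simp
  qed
  have "(\<lambda>_. 1) \<in> form_prods n (\<xi> i) 0" for i
    using form_power_in_prods[of n "\<xi> i" _ 0] by simp
  with expand[of d "\<lambda>_. 0" "\<lambda>_ _. 1"] show ?thesis by simp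
qed

text \<open>Elements of a submodule vanish outside \<open>carrier_vec n\<close>, while products of
  forms need not. The preimage under \<open>restrict0\<close> is a subspace of total functions, to
  which the results above apply.\<close>

lemma subspace_restrict0:
  fixes U :: "('w \<Rightarrow> 'k::field) set"
  assumes "fun_space.subspace U"
  shows "fun_space.subspace {f. restrict0 W f \<in> U}"
proof (rule fun_space.subspaceI)
  have "restrict0 W (0 :: 'w \<Rightarrow> 'k) = 0" by (auto simp: restrict0_def)
  then show "(0 :: 'w \<Rightarrow> 'k) \<in> {f. restrict0 W f \<in> U}"
    using fun_space.subspace_0[OF assms] by simp
next
  fix f g :: "'w \<Rightarrow> 'k"
  have "restrict0 W (f + g) = restrict0 W f + restrict0 W g" by (auto simp: restrict0_def)
  then show "f + g \<in> {f. restrict0 W f \<in> U}"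
    if "f \<in> {f. restrict0 W f \<in> U}" "g \<in> {f. restrict0 W f \<in> U}"
    using that fun_space.subspace_add[OF assms] by simp
next
  fix c and f :: "'w \<Rightarrow> 'k"
  have "restrict0 W (fun_scale c f) = fun_scale c (restrict0 W f)" by (auto simp: restrict0_def)
  then show "fun_scale c f \<in> {f. restrict0 W f \<in> U}" if "f \<in> {f. restrict0 W f \<in> U}"
    using that fun_space.subspace_scale[OF assms] by simp
qed

text \<open>All \<open>c i\<close> are combinations of the first \<open>m\<close> rows of one
  invertible \<open>h\<close>, so the product is a pullback from \<open>m\<close>-tuples composed
  with \<open>h\<close>.\<close>

lemma (in vector_space) form_powers_in_GL_submodule:
  assumes U: "GL_submodule scale n U" "pullback m n ` kV_hom scale m d \<subseteq> U" and "m \<le> n"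
    and \<xi>: "\<And>i. i < m \<Longrightarrow> \<xi> i \<in> dual_space scale UNIV" and e: "(\<Sum>i<m. e i) = d"
  shows "restrict0 (carrier_vec n) (\<lambda>x. \<Prod>i<m. form n (\<xi> i) (c i) x ^ e i) \<in> U"
proof -
  interpret GL: group "GL n :: 'a mat monoid" by (rule group_GL)
  obtain h c' where h: "h \<in> carrier (GL n)"
    and c': "\<And>i j. i < m \<Longrightarrow> j < n \<Longrightarrow> c i j = (\<Sum>k<m. c' i k * h $$ (k, j))"
    using GL_rows_span[OF \<open>m \<le> n\<close>, of c] by blast
  define f where "f = restrict0 (carrier_vec m) (\<lambda>x. \<Prod>i<m. form m (\<xi> i) (c' i) x ^ e i)"
  have "f \<in> kV_hom scale m d"
    unfolding f_def e[symmetric] by (intro hom_poly_funs_prod_powers form_in_dual_space \<xi>)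
  \<comment> \<open>\<open>fun_act\<close> substitutes the inverse, so acting by the inverse of
    \<open>h\<close> substitutes \<open>h\<close> itself.\<close>
  then have "fun_act scale n (inv\<^bsub>GL n\<^esub> h) (pullback m n f) \<in> U"
    using U h unfolding GL_submodule_def by auto
  moreover have "fun_act scale n (inv\<^bsub>GL n\<^esub> h) (pullback m n f) =
      restrict0 (carrier_vec n) (\<lambda>x. \<Prod>i<m. form n (\<xi> i) (c i) x ^ e i)"
    unfolding fun_act_def
  proof (rule restrict0_eqI)
    fix x :: "'b vec"
    have act_carrier: "tuple_act scale n h x \<in> carrier_vec n" by (simp add: tuple_act_def)
    have "form n (\<xi> i) (\<lambda>j. \<Sum>k<m. c' i k * h $$ (k, j)) x = form n (\<xi> i) (c i) x" if "i < m" for i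
      using c'[OF that] by (simp add: form_def)
    then show "pullback m n f (tuple_act scale n (inv\<^bsub>GL n\<^esub> (inv\<^bsub>GL n\<^esub> h)) x) =
        (\<Prod>i<m. form n (\<xi> i) (c i) x ^ e i)"
      using h \<xi> \<open>m \<le> n\<close> act_carrier
      by (simp add: pullback_def restrict0_def f_def form_tuple_act)
  qed
  ultimately show ?thesis by simp
qed

theorem theorem5p1:
  fixes scale :: "'k::field \<Rightarrow> 'v::ab_group_add \<Rightarrow> 'v"
    and Basis :: "'v set"
    and l m n d :: nat
  assumes "infinite (UNIV :: 'k set)"
    and "finite_dimensional_vector_space scale Basis"
    and "vector_space.dim scale (UNIV :: 'v set) = l"
    and "l \<le> m" and "m \<le> n"
    and "CHAR('k) > 0 \<longrightarrow> d \<le> (CHAR('k) - 1) * m"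
  shows "kV_hom scale n d = GL_span scale n (pullback m n ` kV_hom scale m d)"
proof
  interpret V: finite_dimensional_vector_space scale Basis by fact
  show "GL_span scale n (pullback m n ` kV_hom scale m d) \<subseteq> kV_hom scale n d"
    unfolding GL_span_def using pullback_hom_poly_funs[OF assms(5)] V.GL_submodule_kV_hom
    by (intro hull_minimal) auto
  have "kV_hom scale n d \<subseteq> U"
    if U: "GL_submodule scale n U" "pullback m n ` kV_hom scale m d \<subseteq> U" for U
  proof -
    define N where "N = {f. restrict0 (carrier_vec n) f \<in> U}"
    have sub_U: "fun_space.subspace U" using U(1) by (simp add: GL_submodule_def)
    then have sub_N: "fun_space.subspace N" unfolding N_def by (rule subspace_restrict0)
    obtain b where b: "bij_betw b {..<l} Basis"
      using ex_bij_betw_nat_finite[OF V.finite_Basis] assms(3) by (auto simp: atLeast0LessThan)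
    \<comment> \<open>The \<open>l\<close> coordinate forms are padded with zeros, so that the
      number of rows is the \<open>m\<close> of the degree bound.\<close>
    define \<xi> where "\<xi> i = (if i < l then \<lambda>v. V.representation Basis v (b i) else (\<lambda>_. 0))" for i
    have \<xi>: "\<xi> i \<in> dual_space scale UNIV" for i
      by (simp add: \<xi>_def dual_space_def V.representation_add V.representation_scale
          V.independent_Basis V.span_Basis)
    have rows: "(\<lambda>x. \<Prod>i<m. f i x) \<in> N"
      if "(\<Sum>i<m. e i) = d" "\<And>i. i < m \<Longrightarrow> f i \<in> form_prods n (\<xi> i) (e i)" for e f
    proof (rule balance_rows[OF assms(1) sub_N _ _ assms(6) that(1) _ that(2)])
      show "(\<lambda>v. \<zeta> v + s * \<eta> v) \<in> dual_space scale UNIV"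
        if "\<zeta> \<in> dual_space scale UNIV" "\<eta> \<in> dual_space scale UNIV" for \<zeta> \<eta> s
        using that by (rule dual_space_UNIV_add_scale)
      show "(\<lambda>x. \<Prod>i<m. form n (\<xi>' i) (c i) x ^ e' i) \<in> N"
        if "\<And>i. i < m \<Longrightarrow> \<xi>' i \<in> dual_space scale UNIV" "(\<Sum>i<m. e' i) = d" for \<xi>' c e'
        unfolding N_def using V.form_powers_in_GL_submodule[OF U assms(5) that] by simp
    qed (rule \<xi>)
    have "restrict0 (carrier_vec n) (\<lambda>x. \<Prod>t<d. z t x) \<in> U"
      if z: "\<forall>t<d. z t \<in> dual_space (tuple_scale scale) (carrier_vec n)" for z
    proof -
      \<comment> \<open>For \<open>i \<ge> l\<close> the vector \<open>b i\<close> is unspecified,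
        but there \<open>\<xi> i\<close> is zero.\<close>
      define c where "c t i = (\<lambda>j. z t (vec n (\<lambda>k. if k = j then b i else 0)))" for t i
      have expansion: "z t x = (\<Sum>i<m. form n (\<xi> i) (c t i) x)" if "t < d" "x \<in> carrier_vec n" for t x
      proof -
        have "z t x = (\<Sum>i<l. form n (\<xi> i) (c t i) x)"
          using V.dual_space_expansion[OF _ that(2), of "z t"] z that(1)
          by (simp add: c_def \<xi>_def sum.reindex_bij_betw[OF b, symmetric])
        also have "\<dots> = (\<Sum>i<m. form n (\<xi> i) (c t i) x)"
          using assms(4) by (intro sum.mono_neutral_left) (auto simp: \<xi>_def form_def)
        finally show ?thesis .
      qed
      have "restrict0 (carrier_vec n) (\<lambda>x. \<Prod>t<d. \<Sum>i<m. form n (\<xi> i) (c t i) x) \<in> U"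
        using prod_of_form_sums[OF sub_N rows] by (simp add: N_def)
      moreover have "restrict0 (carrier_vec n) (\<lambda>x. \<Prod>t<d. \<Sum>i<m. form n (\<xi> i) (c t i) x) =
          restrict0 (carrier_vec n) (\<lambda>x. \<Prod>t<d. z t x)"
        by (rule restrict0_eqI) (simp add: expansion)
      ultimately show ?thesis by simp
    qed
    then show ?thesis
      unfolding hom_poly_funs_def by (intro fun_space.span_minimal sub_U) auto
  qed
  then show "kV_hom scale n d \<subseteq> GL_span scale n (pullback m n ` kV_hom scale m d)"
    unfolding GL_span_def hull_def by blast
qed

end
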